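(* Let $0<q\le1$ and let $\phi\in L^\infty(\mathbb{T})$. Then the $q$-Berezin range of the Toeplitz operator $T_\phi$ is given by $$\mathrm{Ber}_q(T_{\phi})=\left\{\frac{q}{2\pi}\int_0^{2\pi}\frac{\phi(e^{it})(1-\overline{w_1}w_2)}{(1-\overline{w_1}e^{it})(1-w_2e^{-it})}\,dt:\ w_1\in\mathbb{D},\ w_2\in\mathcal{S}_{w_1}\right\}.$$
   Context: $\mathbb{D}$ is the open unit disc and $\mathbb{T}$ the unit circle in $\mathbb{C}$. $H^2(\mathbb{D})$ is the Hardy space of analytic functions $\sum_{n\ge0}a_nz^n$ on $\mathbb{D}$ with $\sum|a_n|^2<\infty$ and inner product $\langle\sum a_nz^n,\sum b_nz^n\rangle=\sum a_n\overline{b_n}$; it is identified isometrically with the closed subspace $\widetilde{H}^2$ of $L^2(\mathbb{T})$ (normalized Lebesgue measure) of functions $\sum_{n\ge0}a_ne^{in\theta}$ with $\sum|a_n|^2<\infty$, via $\sum a_n z^n\leftrightarrow\sum a_ne^{in\theta}$. Its reproducing kernel at $w\in\mathbb{D}$ is $k_w(z)=\frac{1}{1-\overline{w}z}$, and $\hat{k}_w=k_w/\|k_w\|$. $P_+$ is the orthogonal projection of $L^2(\mathbb{T})$ onto $\widetilde{H}^2$, and for $\phi\in L^\infty(\mathbb{T})$ the Toeplitz operator is $T_\phi f=P_+(\phi f)$, $f\in\widetilde{H}^2$, regarded as a bounded operator on $H^2(\mathbb{D})$. For $0<q\le1$ and $w_1\in\mathbb{D}$, $\mathcal{S}_{w_1}=\{w_2\in\mathbb{D}:\langle\hat{k}_{w_1},\hat{k}_{w_2}\rangle=q\}$,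 and for a bounded operator $T$ on $H^2(\mathbb{D})$ the $q$-Berezin range is $\mathrm{Ber}_q(T)=\{\langle T\hat{k}_{w_1},\hat{k}_{w_2}\rangle: w_1\in\mathbb{D},\ w_2\in\mathcal{S}_{w_1}\}$. *)

theory Defs
  imports "HOL-Complex_Analysis.Complex_Analysis" "HOL-Probability.Probability"
begin

abbreviation unit_disc :: "complex set" where
  "unit_disc \<equiv> ball 0 1"

section \<open>The Hardy space on the disc\<close>

definition taylor_coeff :: "(complex \<Rightarrow> complex) \<Rightarrow> nat \<Rightarrow> complex" where
  "taylor_coeff f n = fps_nth (fps_expansion f 0) n"

text \<open>A function on the disc is represented by the total function that vanishes off the disc,
  so that two elements of \<open>hardy2\<close> are equal iff they agree on the disc.\<close>

definition hardy2 :: "(complex \<Rightarrow> complex) set" where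
  "hardy2 = {f. f holomorphic_on unit_disc \<and> (\<forall>z. z \<notin> unit_disc \<longrightarrow> f z = 0) \<and>
                summable (\<lambda>n. (cmod (taylor_coeff f n))\<^sup>2)}"

definition hardy_inner :: "(complex \<Rightarrow> complex) \<Rightarrow> (complex \<Rightarrow> complex) \<Rightarrow> complex" where
  "hardy_inner f g = (\<Sum>n. taylor_coeff f n * cnj (taylor_coeff g n))"

definition hardy_norm :: "(complex \<Rightarrow> complex) \<Rightarrow> real" where
  "hardy_norm f = sqrt (Re (hardy_inner f f))"

definition kernel :: "complex \<Rightarrow> complex \<Rightarrow> complex" where
  "kernel w z = (if z \<in> unit_disc then 1 / (1 - cnj w * z) else 0)"

definition nkernel :: "complex \<Rightarrow> complex \<Rightarrow> complex" where
  "nkernel w z = kernel w z / of_real (hardy_norm (kernel w))"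

section \<open>Function spaces on the circle\<close>

text \<open>Elements of \<open>L\<^sup>2\<close> and \<open>L\<^sup>\<infinity>\<close> of the circle are represented by Borel functions
  on the circle; equality in these spaces is equality almost everywhere.\<close>

definition circle_measure :: "complex measure" where
  "circle_measure = distr (uniform_measure lborel {0..2*pi}) (restrict_space borel (sphere 0 1)) cis"

definition L2_circle :: "(complex \<Rightarrow> complex) set" where
  "L2_circle = {g \<in> borel_measurable circle_measure.
                  integrable circle_measure (\<lambda>z. (cmod (g z))\<^sup>2)}"

definition Linf_circle :: "(complex \<Rightarrow> complex) set" where
  "Linf_circle = {g \<in> borel_measurable circle_measure.
                    \<exists>C. AE z in circle_measure. cmod (g z) \<le> C}"

definition L2_inner :: "(complex \<Rightarrow> complex) \<Rightarrow> (complex \<Rightarrow> complex) \<Rightarrow> complex" where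
  "L2_inner f g = (\<integral>z. f z * cnj (g z) \<partial>circle_measure)"

text \<open>\<open>g = (\<Sum>n. a n * z ^ n)\<close> on the circle, with convergence in \<open>L\<^sup>2\<close>.\<close>

definition L2_sums :: "(nat \<Rightarrow> complex) \<Rightarrow> (complex \<Rightarrow> complex) \<Rightarrow> bool" where
  "L2_sums a g \<longleftrightarrow> g \<in> L2_circle \<and>
     (\<lambda>N. \<integral>z. (cmod (g z - (\<Sum>n<N. a n * z ^ n)))\<^sup>2 \<partial>circle_measure) \<longlonglongrightarrow> 0"

definition hardy2_circle :: "(complex \<Rightarrow> complex) set" where
  "hardy2_circle = {g. \<exists>a. summable (\<lambda>n. (cmod (a n))\<^sup>2) \<and> L2_sums a g}"

text \<open>The identification of \<open>hardy2\<close> with \<open>hardy2_circle\<close>; the choice is among representatives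
  of one and the same \<open>L\<^sup>2\<close> class.\<close>

definition boundary :: "(complex \<Rightarrow> complex) \<Rightarrow> complex \<Rightarrow> complex" where
  "boundary f = (SOME g. L2_sums (taylor_coeff f) g)"

text \<open>The orthogonal projection of \<open>L\<^sup>2\<close> onto \<open>hardy2_circle\<close>; again only the representative
  is chosen.\<close>

definition P_plus :: "(complex \<Rightarrow> complex) \<Rightarrow> complex \<Rightarrow> complex" where
  "P_plus u = (SOME h. h \<in> hardy2_circle \<and>
                 (\<forall>g\<in>hardy2_circle. L2_inner (\<lambda>z. u z - h z) g = 0))"

section \<open>Toeplitz operators and the \<open>q\<close>-Berezin range\<close>

text \<open>The operator acts on \<open>hardy2\<close>: the projection is transported back to the disc along
  \<open>boundary\<close>.\<close>

definition toeplitz :: "(complex \<Rightarrow> complex) \<Rightarrow> (complex \<Rightarrow> complex) \<Rightarrow> complex \<Rightarrow> complex" where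
  "toeplitz \<phi> f = (THE F. F \<in> hardy2 \<and>
     (AE z in circle_measure. boundary F z = P_plus (\<lambda>z. \<phi> z * boundary f z) z))"

definition q_slice :: "real \<Rightarrow> complex \<Rightarrow> complex set" where
  "q_slice q w1 = {w2 \<in> unit_disc. hardy_inner (nkernel w1) (nkernel w2) = of_real q}"

definition q_berezin_range ::
    "real \<Rightarrow> ((complex \<Rightarrow> complex) \<Rightarrow> complex \<Rightarrow> complex) \<Rightarrow> complex set" where
  "q_berezin_range q T =
     {hardy_inner (T (nkernel w1)) (nkernel w2) | w1 w2. w1 \<in> unit_disc \<and> w2 \<in> q_slice q w1}"

end

(* Parseval identifies the Hardy inner product with the L2 inner product of boundary functions.
   As k_w2 has its boundary function in the range of P_+, the projection can be dropped:
   <T_phi k_w1, k_w2> is the integral over the circle of phi * k_w1 * conj k_w2.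
   Normalising the kernels divides this by |k_w1| |k_w2|, and <k_w1, k_w2> = 1 / (1 - conj w1 * w2)
   turns the condition defining the slice into 1 / (|k_w1| |k_w2|) = q (1 - conj w1 * w2).
   The rest is to show that the projection, the boundary functions and the operator, defined by
   choice, exist and are unique up to null sets; the completeness needed is Riesz-Fischer,
   obtained from an almost everywhere convergent subsequence of partial sums and Fatou's lemma. *)

theory Submission
  imports Defs
begin

section \<open>The circle\<close>

lemma space_circle_measure [simp]: "space circle_measure = sphere 0 1"
  by (simp add: circle_measure_def space_restrict_space)

lemma sets_circle_measure [simp, measurable_cong]:
  "sets circle_measure = sets (restrict_space borel (sphere 0 1))"
  by (simp add: circle_measure_def)

lemma cis_measurable_circle [measurable]: "cis \<in> borel \<rightarrow>\<^sub>M restrict_space borel (sphere 0 1)"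
  by (intro measurable_restrict_space2 borel_measurable_continuous_onI continuous_intros)
     (auto simp: norm_cis)

lemma cis_measurable_uniform [measurable]:
  "cis \<in> uniform_measure lborel {0..2*pi} \<rightarrow>\<^sub>M restrict_space borel (sphere 0 1)"
  using cis_measurable_circle
  by (simp add: measurable_def)

lemma cnj_measurable [measurable]: "cnj \<in> borel_measurable borel"
  by (intro borel_measurable_continuous_onI continuous_intros)

lemma borel_measurable_circle_continuousI:
  "continuous_on (sphere 0 1) f \<Longrightarrow> f \<in> borel_measurable circle_measure"
  by (subst measurable_cong_sets[OF sets_circle_measure refl])
     (rule borel_measurable_continuous_on_restrict)

interpretation circle: prob_space circle_measure
  unfolding circle_measure_def
  by (intro prob_space.prob_space_distr prob_space_uniform_measure cis_measurable_uniform) auto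

lemma measure_circle_measure: "measure circle_measure (sphere 0 1) = 1"
  using circle.prob_space by simp

text \<open>Pushforward along \<open>cis\<close>, then the density of the uniform measure.
  Measurability is enough: without integrability both integrals take the default value 0.\<close>

lemma integral_circle_measure:
  fixes f :: "complex \<Rightarrow> complex"
  assumes "f \<in> borel_measurable circle_measure"
  shows "(\<integral>z. f z \<partial>circle_measure) = of_real (1 / (2*pi)) * (LINT t:{0..2*pi}|lborel. f (cis t))"
proof -
  have f [measurable]: "f \<in> borel_measurable (restrict_space borel (sphere 0 1))"
    using assms measurable_cong_sets[OF sets_circle_measure refl] by blast
  \<comment> \<open>The interval has length \<open>2*pi\<close>; written as \<open>ennreal\<close>
    of a real function, the quotient is a density that the Bochner integral can absorb as a scalar
    factor.\<close>
  have dens: "indicator {0..2*pi} x / emeasure lborel {0..2*pi} =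
      ennreal (1 / (2*pi) * indicator {0..2*pi} x)" for x :: real
    by (auto simp: indicator_def divide_ennreal simp flip: ennreal_1)
  have "(\<integral>z. f z \<partial>circle_measure) = (\<integral>t. f (cis t) \<partial>uniform_measure lborel {0..2*pi})"
    unfolding circle_measure_def by (intro integral_distr) measurable
  also have "\<dots> = (\<integral>t. (1 / (2*pi) * indicator {0..2*pi} t) *\<^sub>R f (cis t) \<partial>lborel)"
    unfolding uniform_measure_def dens
    by (intro integral_density) (auto intro!: measurable_compose[OF _ f])
  also have "\<dots> = (\<integral>t. (1 / (2*pi)) *\<^sub>R (indicator {0..2*pi} t *\<^sub>R f (cis t)) \<partial>lborel)"
    by simp
  also have "\<dots> = of_real (1 / (2*pi)) * (LINT t:{0..2*pi}|lborel. f (cis t))"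
    unfolding integral_scaleR_right set_lebesgue_integral_def by (simp add: scaleR_conv_of_real)
  finally show ?thesis .
qed

text \<open>Orthogonality of the characters: for distinct exponents the integrand has a periodic
  antiderivative.\<close>

lemma set_integral_cis_power:
  fixes n m :: nat
  shows "(LINT t:{0..2*pi}|lborel. cis t ^ n * cnj (cis t ^ m)) = (if n = m then of_real (2*pi) else 0)"
proof (cases "n = m")
  case True
  have "(LINT t:{0..2*pi}|lborel. cis t ^ n * cnj (cis t ^ m)) = (LINT t:{0..2*pi}|lborel. 1 :: complex)"
    by (intro set_lebesgue_integral_cong) (auto simp: True cis_cnj cis_mult simp flip: power_mult_distrib)
  then show ?thesis
    using True by (simp add: set_lebesgue_integral_def scaleR_conv_of_real)
next
  case False
  \<comment> \<open>The difference is taken in the reals, since it may be negative.\<close>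
  define k where "k = real n - real m"
  have k: "k \<noteq> 0"
    using False by (simp add: k_def)
  have eq: "cis t ^ n * cnj (cis t ^ m) = cis (k * t)" for t
    unfolding complex_cnj_power cis_cnj Complex.DeMoivre cis_mult by (simp add: k_def algebra_simps)
  have "k * (2*pi) = 2*pi*n - 2*pi*m"
    by (simp add: k_def left_diff_distrib mult.commute)
  then have per: "cis (k * (2*pi)) = 1"
    by (simp only: cis_divide[symmetric] cis_multiple_2pi Ints_of_nat div_by_1)
  \<comment> \<open>Antiderivative of \<open>cis (k * x)\<close>; by \<open>per\<close> it takes the
    same value at both endpoints. Its derivative is that of the complex exponential, restricted to
    the real line.\<close>
  define F where "F x = cis (k * x) / (\<i> * k)" for x
  have "(\<integral>x. indicator {0..2*pi} x *\<^sub>R cis (k * x) \<partial>lborel) = F (2*pi) - F 0"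
  proof (rule integral_FTC_Icc)
    show "(0::real) \<le> 2*pi" by simp
    fix x
    have "((\<lambda>z. exp (\<i> * k * z) / (\<i> * k)) has_field_derivative exp (\<i> * k * of_real x)) (at (of_real x))"
      using k by (auto intro!: derivative_eq_intros)
    from has_vector_derivative_real_field[OF this]
    show "(F has_vector_derivative cis (k * x)) (at x within {0..2*pi})"
      by (simp add: F_def[abs_def] cis_conv_exp mult.assoc)
    show "continuous_on {0..2*pi} (\<lambda>x. cis (k * x))"
      by (intro continuous_intros)
  qed
  then show ?thesis
    using False per by (simp add: set_lebesgue_integral_def eq F_def del: complex_cnj_power)
qed

section \<open>Square integrable functions on the circle\<close>

lemma L2_circleD:
  assumes "f \<in> L2_circle"
  shows "f \<in> borel_measurable circle_measure" "integrable circle_measure (\<lambda>z. (cmod (f z))\<^sup>2)"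
  using assms by (auto simp: L2_circle_def)

lemma bounded_in_L2_circle:
  assumes "f \<in> borel_measurable circle_measure" "AE z in circle_measure. cmod (f z) \<le> C"
  shows "f \<in> L2_circle"
proof -
  have "integrable circle_measure (\<lambda>z. (cmod (f z))\<^sup>2)"
  proof (rule circle.integrable_const_bound[where B = "C\<^sup>2"])
    show "AE z in circle_measure. norm ((cmod (f z))\<^sup>2) \<le> C\<^sup>2"
      using assms(2) by eventually_elim (auto intro: power_mono)
  qed (use assms(1) in measurable)
  with assms show ?thesis by (simp add: L2_circle_def)
qed

lemma Linf_mult_L2_circle:
  assumes "\<phi> \<in> Linf_circle" "f \<in> L2_circle"
  shows "(\<lambda>z. \<phi> z * f z) \<in> L2_circle"
proof -
  obtain C where \<phi> [measurable]: "\<phi> \<in> borel_measurable circle_measure"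
    and C: "AE z in circle_measure. cmod (\<phi> z) \<le> C"
    using assms(1) by (auto simp: Linf_circle_def)
  note [measurable] = L2_circleD(1)[OF assms(2)]
  have "integrable circle_measure (\<lambda>z. C\<^sup>2 * (cmod (f z))\<^sup>2)"
    using L2_circleD(2)[OF assms(2)] by simp
  then have "integrable circle_measure (\<lambda>z. (cmod (\<phi> z * f z))\<^sup>2)"
  proof (rule Bochner_Integration.integrable_bound)
    show "AE z in circle_measure. norm ((cmod (\<phi> z * f z))\<^sup>2) \<le> norm (C\<^sup>2 * (cmod (f z))\<^sup>2)"
      using C by eventually_elim (auto simp: norm_mult power_mult_distrib intro!: mult_right_mono power_mono)
  qed simp
  then show ?thesis by (simp add: L2_circle_def)
qed

text \<open>Domination by \<open>2 * |f|^2 + 2 * |g|^2\<close>, from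
  \<open>2ab <= a^2 + b^2\<close>.\<close>

lemma L2_circle_add:
  assumes "f \<in> L2_circle" "g \<in> L2_circle"
  shows "(\<lambda>z. f z + g z) \<in> L2_circle"
proof -
  note [measurable] = L2_circleD(1)[OF assms(1)] L2_circleD(1)[OF assms(2)]
  have "integrable circle_measure (\<lambda>z. 2 * (cmod (f z))\<^sup>2 + 2 * (cmod (g z))\<^sup>2)"
    using L2_circleD(2)[OF assms(1)] L2_circleD(2)[OF assms(2)] by simp
  then have "integrable circle_measure (\<lambda>z. (cmod (f z + g z))\<^sup>2)"
  proof (rule Bochner_Integration.integrable_bound)
    have "norm ((cmod (f z + g z))\<^sup>2) \<le> norm (2 * (cmod (f z))\<^sup>2 + 2 * (cmod (g z))\<^sup>2)" for z
    proof -
      have "(cmod (f z + g z))\<^sup>2 \<le> (cmod (f z) + cmod (g z))\<^sup>2"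
        by (intro power_mono norm_triangle_ineq) simp
      also have "\<dots> \<le> 2 * (cmod (f z))\<^sup>2 + 2 * (cmod (g z))\<^sup>2"
        using sum_squares_bound[of "cmod (f z)" "cmod (g z)"] unfolding power2_sum by linarith
      finally show ?thesis
        unfolding real_norm_def by (subst (1 2) abs_of_nonneg) simp_all
    qed
    then show "AE z in circle_measure. norm ((cmod (f z + g z))\<^sup>2) \<le>
        norm (2 * (cmod (f z))\<^sup>2 + 2 * (cmod (g z))\<^sup>2)"
      by (intro AE_I2)
  qed measurable
  then show ?thesis by (simp add: L2_circle_def)
qed

lemma L2_circle_scale: "f \<in> L2_circle \<Longrightarrow> (\<lambda>z. c * f z) \<in> L2_circle"
  by (auto simp: L2_circle_def norm_mult power_mult_distrib)

lemma L2_circle_diff: "f \<in> L2_circle \<Longrightarrow> g \<in> L2_circle \<Longrightarrow> (\<lambda>z. f z - g z) \<in> L2_circle"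
  using L2_circle_add[of f "\<lambda>z. (-1) * g z"] L2_circle_scale[of g "-1"] by simp

lemma L2_circle_zero: "(\<lambda>z. 0) \<in> L2_circle"
  by (simp add: L2_circle_def)

lemma L2_circle_sum:
  "(\<And>i. i \<in> I \<Longrightarrow> f i \<in> L2_circle) \<Longrightarrow> (\<lambda>z. \<Sum>i\<in>I. f i z) \<in> L2_circle"
  by (induction I rule: infinite_finite_induct) (auto intro: L2_circle_add L2_circle_zero)

lemma power_in_L2_circle: "(\<lambda>z. z ^ n) \<in> L2_circle"
  by (rule bounded_in_L2_circle[where C = 1])
     (auto intro!: AE_I2 borel_measurable_circle_continuousI continuous_intros simp: norm_power)

lemma poly_in_L2_circle: "(\<lambda>z. \<Sum>n\<in>I. a n * z ^ n) \<in> L2_circle"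
  by (intro L2_circle_sum L2_circle_scale power_in_L2_circle)

text \<open>Domination by \<open>|f|^2 + |g|^2\<close>. This makes \<open>L2_inner\<close> additive
  on \<open>L2_circle\<close>: the Bochner integral of a non-integrable function is 0 by default and
  does not split over sums.\<close>

lemma L2_circle_integrable_mult:
  assumes "f \<in> L2_circle" "g \<in> L2_circle"
  shows "integrable circle_measure (\<lambda>z. f z * cnj (g z))"
proof -
  note [measurable] = L2_circleD(1)[OF assms(1)] L2_circleD(1)[OF assms(2)]
  have "integrable circle_measure (\<lambda>z. (cmod (f z))\<^sup>2 + (cmod (g z))\<^sup>2)"
    using L2_circleD(2)[OF assms(1)] L2_circleD(2)[OF assms(2)] by simp
  then show ?thesis
  proof (rule Bochner_Integration.integrable_bound)
    have "cmod (f z) * cmod (g z) \<le> (cmod (f z))\<^sup>2 + (cmod (g z))\<^sup>2" for z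
    proof -
      have "0 \<le> cmod (f z) * cmod (g z)"
        by simp
      then show ?thesis
        using sum_squares_bound[of "cmod (f z)" "cmod (g z)"] by linarith
    qed
    then show "AE z in circle_measure. norm (f z * cnj (g z)) \<le>
        norm ((cmod (f z))\<^sup>2 + (cmod (g z))\<^sup>2)"
      by (intro AE_I2) (simp add: norm_mult)
  qed measurable
qed

section \<open>Sesquilinearity, Cauchy-Schwarz and continuity of the inner product\<close>

lemma L2_inner_diff:
  "f \<in> L2_circle \<Longrightarrow> f' \<in> L2_circle \<Longrightarrow> g \<in> L2_circle \<Longrightarrow>
    L2_inner (\<lambda>z. f z - f' z) g = L2_inner f g - L2_inner f' g"
  by (simp add: L2_inner_def left_diff_distrib L2_circle_integrable_mult)

lemma L2_inner_scale: "L2_inner (\<lambda>z. c * f z) g = c * L2_inner f g"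
  by (simp add: L2_inner_def mult.assoc)

lemma L2_inner_commute: "L2_inner g f = cnj (L2_inner f g)"
  unfolding L2_inner_def
  by (subst Bochner_Integration.integral_cnj [symmetric]) (simp add: mult.commute)

lemma L2_inner_diff_right:
  assumes "f \<in> L2_circle" "g \<in> L2_circle" "g' \<in> L2_circle"
  shows "L2_inner f (\<lambda>z. g z - g' z) = L2_inner f g - L2_inner f g'"
  using L2_inner_diff[OF assms(2,3,1)] by (metis L2_inner_commute complex_cnj_diff)

lemma L2_inner_scale_right: "L2_inner f (\<lambda>z. c * g z) = cnj c * L2_inner f g"
  by (metis L2_inner_commute L2_inner_scale complex_cnj_mult)

lemma L2_inner_sum:
  assumes "\<And>i. i \<in> I \<Longrightarrow> f i \<in> L2_circle" "g \<in> L2_circle"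
  shows "L2_inner (\<lambda>z. \<Sum>i\<in>I. f i z) g = (\<Sum>i\<in>I. L2_inner (f i) g)"
  using assms by (simp add: L2_inner_def sum_distrib_right L2_circle_integrable_mult)

lemma L2_inner_self: "L2_inner f f = of_real (\<integral>z. (cmod (f z))\<^sup>2 \<partial>circle_measure)"
  by (simp add: L2_inner_def complex_norm_square[symmetric] flip: integral_complex_of_real)

text \<open>\<open>boundary\<close> and \<open>P_plus\<close> pick representatives that are
  determined only up to null sets; this makes inner products independent of the pick.\<close>

lemma L2_inner_cong_AE:
  assumes "f \<in> L2_circle" "f' \<in> L2_circle" "g \<in> L2_circle" "g' \<in> L2_circle"
    "AE z in circle_measure. f z = f' z" "AE z in circle_measure. g z = g' z"
  shows "L2_inner f g = L2_inner f' g'"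
  unfolding L2_inner_def
proof (rule integral_cong_AE)
  show "AE z in circle_measure. f z * cnj (g z) = f' z * cnj (g' z)"
    using assms(5,6) by eventually_elim simp
qed (use assms(1-4)[THEN L2_circleD(1)] in measurable)

lemma L2_norm_eq_0_iff:
  assumes "f \<in> L2_circle"
  shows "(\<integral>z. (cmod (f z))\<^sup>2 \<partial>circle_measure) = 0 \<longleftrightarrow> (AE z in circle_measure. f z = 0)"
  using L2_circleD(2)[OF assms] by (subst integral_nonneg_eq_0_iff_AE) auto

text \<open>The squared norm of \<open>B * f - c * g\<close> expands to
  \<open>B * (A * B - |c|^2)\<close>, which is therefore nonnegative, and \<open>B > 0\<close> can
  be cancelled.\<close>

lemma L2_inner_Cauchy_Schwarz:
  assumes "f \<in> L2_circle" "g \<in> L2_circle"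
  shows "(cmod (L2_inner f g))\<^sup>2 \<le>
    (\<integral>z. (cmod (f z))\<^sup>2 \<partial>circle_measure) * (\<integral>z. (cmod (g z))\<^sup>2 \<partial>circle_measure)"
proof -
  define A where "A = (\<integral>z. (cmod (f z))\<^sup>2 \<partial>circle_measure)"
  define B where "B = (\<integral>z. (cmod (g z))\<^sup>2 \<partial>circle_measure)"
  define c where "c = L2_inner f g"
  have "(cmod c)\<^sup>2 \<le> A * B"
  \<comment> \<open>If \<open>B = 0\<close> then \<open>g\<close> vanishes almost everywhere, and so
    does the inner product.\<close>
  proof (cases "B = 0")
    case True
    then have "AE z in circle_measure. g z = 0"
      using assms L2_norm_eq_0_iff by (simp add: B_def)
    then have "c = L2_inner f (\<lambda>z. 0)"
      unfolding c_def using assms L2_circle_zero by (intro L2_inner_cong_AE) auto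
    then show ?thesis
      by (simp add: L2_inner_def True)
  next
    case False
    then have "B > 0"
      by (simp add: B_def order_less_le)
    \<comment> \<open>\<open>B\<close> times the component of \<open>f\<close> orthogonal to
      \<open>g\<close>; the factor \<open>B\<close> avoids a division.\<close>
    define u where "u z = B * f z - c * g z" for z
    have ff: "L2_inner f f = of_real A" and gg: "L2_inner g g = of_real B"
      and gf: "L2_inner g f = cnj c"
      by (simp_all only: L2_inner_self A_def B_def c_def L2_inner_commute[of g f])
    have "of_real (\<integral>z. (cmod (u z))\<^sup>2 \<partial>circle_measure) = L2_inner u u"
      by (simp add: L2_inner_self)
    also have "\<dots> = B * (B * A) - B * (cnj c * c) - (c * (B * cnj c) - c * (cnj c * B))"
      unfolding u_def
      by (simp add: L2_inner_diff L2_inner_diff_right L2_circle_diff L2_circle_scale assms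
          L2_inner_scale L2_inner_scale_right ff gg gf c_def[symmetric] del: right_diff_distrib)
         (simp add: algebra_simps)
    also have "\<dots> = of_real (B * (A * B - (cmod c)\<^sup>2))"
      by (simp only: of_real_mult of_real_diff complex_norm_square) (simp add: algebra_simps)
    finally have "B * (A * B - (cmod c)\<^sup>2) = (\<integral>z. (cmod (u z))\<^sup>2 \<partial>circle_measure)"
      by (simp only: of_real_eq_iff)
    then have "0 \<le> B * (A * B - (cmod c)\<^sup>2)"
      by simp
    with \<open>B > 0\<close> show ?thesis
      by (simp add: zero_le_mult_iff)
  qed
  then show ?thesis by (simp add: A_def B_def c_def)
qed

text \<open>Cauchy-Schwarz bounds the error by the norm of \<open>f - F n\<close> times that of
  \<open>g\<close>.\<close>

lemma L2_inner_tendsto: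
  assumes F: "\<And>n. F n \<in> L2_circle" and f: "f \<in> L2_circle" and g: "g \<in> L2_circle"
    and lim: "(\<lambda>n::nat. \<integral>z. (cmod (f z - F n z))\<^sup>2 \<partial>circle_measure) \<longlonglongrightarrow> 0"
  shows "(\<lambda>n. L2_inner (F n) g) \<longlonglongrightarrow> L2_inner f g"
proof -
  define B where "B = (\<integral>z. (cmod (g z))\<^sup>2 \<partial>circle_measure)"
  define e where "e n = (\<integral>z. (cmod (f z - F n z))\<^sup>2 \<partial>circle_measure)" for n
  have "(\<lambda>n. sqrt (e n * B)) \<longlonglongrightarrow> sqrt (0 * B)"
    using lim unfolding e_def by (intro tendsto_intros)
  then have "(\<lambda>n. sqrt (e n * B)) \<longlonglongrightarrow> 0"
    by simp
  moreover have "\<forall>\<^sub>F n in sequentially. norm (L2_inner f g - L2_inner (F n) g) \<le> sqrt (e n * B)"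
    using L2_inner_Cauchy_Schwarz[OF L2_circle_diff[OF f F] g]
    by (intro always_eventually allI real_le_rsqrt) (simp add: L2_inner_diff f g F e_def B_def)
  ultimately have "(\<lambda>n. L2_inner f g - L2_inner (F n) g) \<longlonglongrightarrow> 0"
    by (rule Lim_null_comparison[rotated])
  from tendsto_diff[OF tendsto_const this, of "L2_inner f g"] show ?thesis
    by simp
qed

section \<open>Fourier coefficients\<close>

lemma L2_inner_power: "L2_inner (\<lambda>z. z ^ n) (\<lambda>z. z ^ m) = (if n = m then 1 else 0)"
proof -
  have "L2_inner (\<lambda>z. z ^ n) (\<lambda>z. z ^ m) =
      of_real (1 / (2*pi)) * (LINT t:{0..2*pi}|lborel. cis t ^ n * cnj (cis t ^ m))"
    unfolding L2_inner_def
    by (intro integral_circle_measure borel_measurable_circle_continuousI continuous_intros)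
  then show ?thesis
    by (simp add: set_integral_cis_power del: complex_cnj_power)
qed

lemma L2_inner_poly_power:
  assumes "finite I"
  shows "L2_inner (\<lambda>z. \<Sum>n\<in>I. a n * z ^ n) (\<lambda>z. z ^ m) = (if m \<in> I then a m else 0)"
proof -
  have "L2_inner (\<lambda>z. \<Sum>n\<in>I. a n * z ^ n) (\<lambda>z. z ^ m) = (\<Sum>n\<in>I. a n * (if n = m then 1 else 0))"
    by (subst L2_inner_sum) (auto intro: L2_circle_scale power_in_L2_circle simp: L2_inner_scale L2_inner_power)
  with assms show ?thesis
    by (simp add: if_distrib[of "\<lambda>x. a _ * x"] cong: if_cong)
qed

lemma L2_inner_poly_right:
  assumes "u \<in> L2_circle"
  shows "L2_inner u (\<lambda>z. \<Sum>n\<in>I. b n * z ^ n) = (\<Sum>n\<in>I. L2_inner u (\<lambda>z. z ^ n) * cnj (b n))"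
proof -
  have "L2_inner u (\<lambda>z. \<Sum>n\<in>I. b n * z ^ n) = cnj (L2_inner (\<lambda>z. \<Sum>n\<in>I. b n * z ^ n) u)"
    by (rule L2_inner_commute)
  also have "\<dots> = (\<Sum>n\<in>I. cnj (b n) * cnj (L2_inner (\<lambda>z. z ^ n) u))"
    by (subst L2_inner_sum) (auto intro: L2_circle_scale power_in_L2_circle assms simp: L2_inner_scale)
  finally show ?thesis
    by (simp add: L2_inner_commute[of u] mult.commute)
qed

text \<open>Pythagoras for orthonormal monomials. The index set is arbitrary finite because the
  Riesz-Fischer argument applies it to blocks \<open>{m..<k}\<close>.\<close>

lemma L2_norm_poly:
  assumes "finite I"
  shows "(\<integral>z. (cmod (\<Sum>n\<in>I. a n * z ^ n))\<^sup>2 \<partial>circle_measure) = (\<Sum>n\<in>I. (cmod (a n))\<^sup>2)"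
proof -
  have "of_real (\<integral>z. (cmod (\<Sum>n\<in>I. a n * z ^ n))\<^sup>2 \<partial>circle_measure) =
      L2_inner (\<lambda>z. \<Sum>n\<in>I. a n * z ^ n) (\<lambda>z. \<Sum>n\<in>I. a n * z ^ n)"
    by (simp add: L2_inner_self)
  also have "\<dots> = (\<Sum>n\<in>I. a n * cnj (a n))"
    unfolding L2_inner_poly_right[OF poly_in_L2_circle]
    by (intro sum.cong refl) (simp add: L2_inner_poly_power assms)
  also have "\<dots> = of_real (\<Sum>n\<in>I. (cmod (a n))\<^sup>2)"
    by (simp only: of_real_sum complex_norm_square)
  finally show ?thesis by (simp only: of_real_eq_iff)
qed

text \<open>Expanding the squared norm of \<open>u - S N\<close> leaves the squared norm of
  \<open>u\<close> minus the partial sum of squares, so these partial sums are bounded.\<close>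

lemma Bessel_inequality:
  assumes "u \<in> L2_circle"
  shows "summable (\<lambda>n. (cmod (L2_inner u (\<lambda>z. z ^ n)))\<^sup>2)"
proof -
  define a where "a n = L2_inner u (\<lambda>z. z ^ n)" for n
  define S where "S N z = (\<Sum>n<N. a n * z ^ n)" for N :: nat and z
  have S: "S N \<in> L2_circle" for N
    unfolding S_def by (rule poly_in_L2_circle)
  \<comment> \<open>\<open>S N\<close> carries the Fourier coefficients of \<open>u\<close>, so this
    cross term is real and equals the squared norm of \<open>S N\<close>.\<close>
  have uS: "L2_inner u (S N) = of_real (\<Sum>n<N. (cmod (a n))\<^sup>2)" for N
    unfolding S_def L2_inner_poly_right[OF assms] a_def[symmetric]
    by (simp only: of_real_sum complex_norm_square)
  have SS: "L2_inner (S N) (S N) = of_real (\<Sum>n<N. (cmod (a n))\<^sup>2)" for N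
    unfolding L2_inner_self by (simp add: S_def L2_norm_poly)
  have "(\<Sum>n<N. (cmod (a n))\<^sup>2) \<le> (\<integral>z. (cmod (u z))\<^sup>2 \<partial>circle_measure)" for N
  proof -
    have "of_real (\<integral>z. (cmod (u z - S N z))\<^sup>2 \<partial>circle_measure) =
        L2_inner (\<lambda>z. u z - S N z) (\<lambda>z. u z - S N z)"
      by (simp add: L2_inner_self)
    also have "\<dots> = of_real ((\<integral>z. (cmod (u z))\<^sup>2 \<partial>circle_measure) - (\<Sum>n<N. (cmod (a n))\<^sup>2))"
      by (simp add: L2_inner_diff L2_inner_diff_right L2_circle_diff assms S L2_inner_commute[of "S N" u]
          uS SS L2_inner_self[of u])
    finally have "(\<integral>z. (cmod (u z - S N z))\<^sup>2 \<partial>circle_measure) =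
        (\<integral>z. (cmod (u z))\<^sup>2 \<partial>circle_measure) - (\<Sum>n<N. (cmod (a n))\<^sup>2)"
      by (simp only: of_real_eq_iff)
    moreover have "0 \<le> (\<integral>z. (cmod (u z - S N z))\<^sup>2 \<partial>circle_measure)"
      by simp
    ultimately show ?thesis by linarith
  qed
  then have "summable (\<lambda>n. (cmod (a n))\<^sup>2)"
    by (intro summableI_nonneg_bounded) simp_all
  then show ?thesis by (simp add: a_def)
qed

lemma L2_sums_in_L2_circle: "L2_sums a g \<Longrightarrow> g \<in> L2_circle"
  unfolding L2_sums_def by (rule conjunct1)

lemma L2_sums_inner_tendsto:
  assumes "L2_sums a g" "u \<in> L2_circle"
  shows "(\<lambda>N. L2_inner (\<lambda>z. \<Sum>n<N. a n * z ^ n) u) \<longlonglongrightarrow> L2_inner g u"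
proof -
  have g: "g \<in> L2_circle" and
    lim: "(\<lambda>N. \<integral>z. (cmod (g z - (\<Sum>n<N. a n * z ^ n)))\<^sup>2 \<partial>circle_measure) \<longlonglongrightarrow> 0"
    using assms(1) unfolding L2_sums_def by blast+
  show ?thesis
    by (rule L2_inner_tendsto[where F = "\<lambda>N z. \<Sum>n<N. a n * z ^ n", OF poly_in_L2_circle g assms(2) lim])
qed

text \<open>The coefficients of an \<open>L2\<close> expansion are its Fourier coefficients, hence
  determined by the function.\<close>

lemma L2_sums_inner_power:
  assumes "L2_sums a h"
  shows "L2_inner h (\<lambda>z. z ^ m) = a m"
proof (rule LIMSEQ_unique)
  show "(\<lambda>N. L2_inner (\<lambda>z. \<Sum>n<N. a n * z ^ n) (\<lambda>z. z ^ m)) \<longlonglongrightarrow> L2_inner h (\<lambda>z. z ^ m)"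
    by (rule L2_sums_inner_tendsto[OF assms power_in_L2_circle])
  show "(\<lambda>N. L2_inner (\<lambda>z. \<Sum>n<N. a n * z ^ n) (\<lambda>z. z ^ m)) \<longlonglongrightarrow> a m"
    \<comment> \<open>The sum over \<open>n < N\<close> contains the index \<open>m\<close> from
      \<open>N = Suc m\<close> on, and the sequence is then constant.\<close>
    by (rule tendsto_eventually, rule eventually_sequentiallyI[of "Suc m"])
       (simp add: L2_inner_poly_power)
qed

text \<open>Parseval with an arbitrary \<open>L2\<close> function on the left, so that it serves the
  Hardy inner product as well as orthogonality to \<open>hardy2_circle\<close>. The partial sums of
  \<open>g\<close> converge in the first argument; conjugation moves them to the second.\<close>

lemma L2_inner_L2_sums:
  assumes "u \<in> L2_circle" "L2_sums b g"
  shows "(\<lambda>n. L2_inner u (\<lambda>z. z ^ n) * cnj (b n)) sums L2_inner u g"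
  using tendsto_cnj[OF L2_sums_inner_tendsto[OF assms(2,1)]]
  by (simp only: L2_inner_commute[of u, symmetric] L2_inner_poly_right[OF assms(1)] sums_def)

lemma L2_inner_L2_sums_eq_0:
  assumes "u \<in> L2_circle" "L2_sums b g" "\<And>n. L2_inner u (\<lambda>z. z ^ n) = 0"
  shows "L2_inner u g = 0"
  using L2_inner_L2_sums[OF assms(1,2)] by (simp add: assms(3) sums_iff)

text \<open>The difference \<open>d\<close> has vanishing Fourier coefficients of nonnegative index,
  so it is orthogonal to \<open>g\<close> and \<open>h\<close>, hence to itself.\<close>

lemma L2_sums_unique_AE:
  assumes "L2_sums a g" "L2_sums a h"
  shows "AE z in circle_measure. g z = h z"
proof -
  define d where "d z = g z - h z" for z
  note L2 = L2_sums_in_L2_circle[OF assms(1)] L2_sums_in_L2_circle[OF assms(2)]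
  have d: "d \<in> L2_circle"
    unfolding d_def by (intro L2_circle_diff L2)
  have d0: "L2_inner d (\<lambda>z. z ^ n) = 0" for n
    unfolding d_def using assms L2
    by (simp add: L2_inner_diff power_in_L2_circle L2_sums_inner_power)
  have "L2_inner d g = 0" "L2_inner d h = 0"
    by (rule L2_inner_L2_sums_eq_0[OF d assms(1) d0] L2_inner_L2_sums_eq_0[OF d assms(2) d0])+
  then have "L2_inner d d = 0"
    using L2_inner_diff_right[OF d L2] by (simp flip: d_def)
  then have "AE z in circle_measure. d z = 0"
    by (simp add: L2_inner_self L2_norm_eq_0_iff d)
  then show ?thesis
    by (simp add: d_def)
qed

section \<open>The Riesz-Fischer theorem and the projection\<close>

lemma Riesz_Fischer:
  assumes "summable (\<lambda>n. (cmod (a n))\<^sup>2)"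
  obtains h where "L2_sums a h"
proof -
  define S where "S N z = (\<Sum>n<N. a n * z ^ n)" for N :: nat and z
  have S_L2: "S N \<in> L2_circle" for N
    unfolding S_def by (rule poly_in_L2_circle)
  note [measurable] = L2_circleD(1)[OF S_L2]
  have S_norm: "(\<integral>z. (cmod (S k z - S m z))\<^sup>2 \<partial>circle_measure) = (\<Sum>n=m..<k. (cmod (a n))\<^sup>2)"
    if "m \<le> k" for m k
  proof -
    have "S k z - S m z = (\<Sum>n=m..<k. a n * z ^ n)" for z
      using that by (simp add: S_def lessThan_atLeast0 sum_diff_nat_ivl)
    then show ?thesis
      by (simp add: L2_norm_poly)
  qed
  have S_commute: "(\<integral>z. (cmod (S k z - S m z))\<^sup>2 \<partial>circle_measure) =
      (\<integral>z. (cmod (S m z - S k z))\<^sup>2 \<partial>circle_measure)" for m k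
    by (simp add: norm_minus_commute)
  \<comment> \<open>By \<open>S_norm\<close> the squared distance of two partial sums is a block of
    the convergent series of squares.\<close>
  have Cauchy: "\<exists>N. \<forall>m\<ge>N. \<forall>k\<ge>N. (\<integral>z. (cmod (S k z - S m z))\<^sup>2 \<partial>circle_measure) \<le> e"
    if e: "e > 0" for e
  proof -
    obtain N where N: "\<And>m n. m \<ge> N \<Longrightarrow> norm (\<Sum>n=m..<n. (cmod (a n))\<^sup>2) < e"
      using assms e unfolding summable_Cauchy by blast
    have le: "(\<integral>z. (cmod (S k z - S m z))\<^sup>2 \<partial>circle_measure) \<le> e" if "N \<le> m" "m \<le> k" for m k
      using N[OF that(1), of k] S_norm[OF that(2)] by simp
    show ?thesis
    proof (intro exI allI impI)
      fix m k assume "N \<le> m" "N \<le> k"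
      then show "(\<integral>z. (cmod (S k z - S m z))\<^sup>2 \<partial>circle_measure) \<le> e"
        using le[of m k] le[of k m] S_commute[of k m] by (cases "m \<le> k") simp_all
    qed
  qed
  \<comment> \<open>The bound is a square so that the \<open>L2\<close> distance is at most
    \<open>(1/2) ^ j\<close>, which is summable.\<close>
  have "\<forall>j. \<exists>N. \<forall>m\<ge>N. \<forall>k\<ge>N.
      (\<integral>z. (cmod (S k z - S m z))\<^sup>2 \<partial>circle_measure) \<le> ((1/2) ^ j)\<^sup>2"
    by (intro allI Cauchy) simp
  then obtain R where R: "\<forall>j. \<forall>m\<ge>R j. \<forall>k\<ge>R j.
      (\<integral>z. (cmod (S k z - S m z))\<^sup>2 \<partial>circle_measure) \<le> ((1/2) ^ j)\<^sup>2"
    by (rule choice[THEN exE])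
  \<comment> \<open>Summing the thresholds makes \<open>r k\<close> exceed every \<open>R j\<close>
    with \<open>j <= k\<close>; the summand \<open>j\<close> makes the indices tend to
    infinity.\<close>
  define r where "r j = j + (\<Sum>i\<le>j. R i)" for j
  have R_le: "R j \<le> r k" if "j \<le> k" for j k
  proof -
    have "R j \<le> (\<Sum>i\<le>k. R i)"
      using that by (intro member_le_sum) auto
    then show ?thesis
      by (simp add: r_def)
  qed
  have r_ge: "R j \<le> r j" "R j \<le> r (Suc j)" "j \<le> r j" for j
    using R_le[of j j] R_le[of j "Suc j"] by (simp_all add: r_def)
  define d where "d j z = S (r (Suc j)) z - S (r j) z" for j z
  have d_L2: "d j \<in> L2_circle" for j
    unfolding d_def by (intro L2_circle_diff S_L2)
  note [measurable] = L2_circleD(1)[OF d_L2]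
  have d_int: "(\<integral>\<^sup>+z. ennreal (cmod (d j z)) \<partial>circle_measure) \<le> ennreal ((1/2) ^ j)" for j
  proof -
    \<comment> \<open>The weight in the AM-GM bound is the \<open>L2\<close> bound itself, so that
      \<open>(c + c^2 / c) / 2\<close> is again \<open>c\<close>.\<close>
    define c :: real where "c = (1/2) ^ j"
    have "c > 0" by (simp add: c_def)
    have sq: "integrable circle_measure (\<lambda>z. (cmod (d j z))\<^sup>2)"
      using L2_circleD(2)[OF d_L2] .
    \<comment> \<open>AM-GM, so that the \<open>L\<^sup>1\<close> norm is controlled by the \<open>L\<^sup>2\<close> norm.\<close>
    have bound: "cmod (d j z) \<le> (c + (cmod (d j z))\<^sup>2 / c) / 2" for z
    proof -
      have "2 * cmod (d j z) * c \<le> (cmod (d j z))\<^sup>2 + c\<^sup>2"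
        by (rule sum_squares_bound)
      with \<open>c > 0\<close> show ?thesis
        by (simp add: field_simps power2_eq_square)
    qed
    have "(\<integral>\<^sup>+z. ennreal (cmod (d j z)) \<partial>circle_measure) \<le>
        (\<integral>\<^sup>+z. ennreal ((c + (cmod (d j z))\<^sup>2 / c) / 2) \<partial>circle_measure)"
      by (intro nn_integral_mono ennreal_leI bound)
    also have "\<dots> = ennreal (\<integral>z. (c + (cmod (d j z))\<^sup>2 / c) / 2 \<partial>circle_measure)"
      using sq \<open>c > 0\<close> by (intro nn_integral_eq_integral) auto
    also have "(\<integral>z. (c + (cmod (d j z))\<^sup>2 / c) / 2 \<partial>circle_measure) =
        (c + (\<integral>z. (cmod (d j z))\<^sup>2 \<partial>circle_measure) / c) / 2"
      using sq by (simp add: measure_circle_measure)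
    also have "\<dots> \<le> (c + c\<^sup>2 / c) / 2"
      using R[rule_format, OF r_ge(1) r_ge(2), of j] \<open>c > 0\<close>
      by (intro divide_right_mono add_left_mono) (auto simp: d_def c_def)
    also have "\<dots> = c"
      using \<open>c > 0\<close> by (simp add: power2_eq_square)
    finally show ?thesis
      unfolding c_def using ennreal_leI by simp
  qed
  have "(\<integral>\<^sup>+z. (\<Sum>j. ennreal (cmod (d j z))) \<partial>circle_measure) =
      (\<Sum>j. \<integral>\<^sup>+z. ennreal (cmod (d j z)) \<partial>circle_measure)"
    by (intro nn_integral_suminf) measurable
  also have "\<dots> \<le> (\<Sum>j. ennreal ((1/2) ^ j))"
    by (intro suminf_le summableI d_int)
  also have "\<dots> = ennreal (\<Sum>j. (1/2) ^ j)"
    by (rule suminf_ennreal2) (simp, rule summable_geometric, simp)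
  also have "\<dots> < \<infinity>"
    by (simp only: infinity_ennreal_def ennreal_less_top)
  finally have "(\<integral>\<^sup>+z. (\<Sum>j. ennreal (cmod (d j z))) \<partial>circle_measure) \<noteq> \<infinity>"
    by simp
  then have "AE z in circle_measure. (\<Sum>j. ennreal (cmod (d j z))) \<noteq> \<infinity>"
    by (intro nn_integral_PInf_AE) measurable
  \<comment> \<open>The \<open>L1\<close> norms of the increments have a finite sum, so almost
    everywhere the increments are absolutely summable; telescoping turns this into convergence of
    \<open>S (r j) z\<close>.\<close>
  then have conv: "AE z in circle_measure. convergent (\<lambda>j. S (r j) z)"
  proof eventually_elim
    fix z assume "(\<Sum>j. ennreal (cmod (d j z))) \<noteq> \<infinity>"
    then have "summable (\<lambda>j. cmod (d j z))"
      by (intro summable_suminf_not_top) auto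
    then have "summable (\<lambda>j. d j z)"
      by (rule summable_norm_cancel)
    then have "convergent (\<lambda>n. \<Sum>j<n. d j z)"
      by (simp add: summable_iff_convergent)
    then have "convergent (\<lambda>n. S (r n) z - S (r 0) z)"
      by (simp add: d_def sum_lessThan_telescope[of "\<lambda>j. S (r j) z"])
    then show "convergent (\<lambda>j. S (r j) z)"
      by (simp add: convergent_diff_const_right_iff)
  qed
  \<comment> \<open>Where the subsequence diverges, on a null set, \<open>lim\<close> has some
    default value; \<open>h\<close> is measurable nevertheless.\<close>
  define h where "h z = lim (\<lambda>j. S (r j) z)" for z
  have h [measurable]: "h \<in> borel_measurable circle_measure"
    unfolding h_def by measurable
  \<comment> \<open>Fatou's lemma with \<open>n\<close> fixed and \<open>j\<close> tending to
    infinity: a Cauchy bound between partial sums passes to the limit \<open>h\<close>. It yields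
    both \<open>h\<close> in \<open>L2_circle\<close> and the convergence.\<close>
  have hS_nn: "(\<integral>\<^sup>+z. ennreal ((cmod (h z - S n z))\<^sup>2) \<partial>circle_measure) \<le> ennreal e"
    if N: "\<And>m k. m \<ge> N \<Longrightarrow> k \<ge> N \<Longrightarrow> (\<integral>z. (cmod (S k z - S m z))\<^sup>2 \<partial>circle_measure) \<le> e"
      and "n \<ge> N" for e N n
  proof -
    have "(\<integral>\<^sup>+z. ennreal ((cmod (h z - S n z))\<^sup>2) \<partial>circle_measure) =
        (\<integral>\<^sup>+z. liminf (\<lambda>j. ennreal ((cmod (S (r j) z - S n z))\<^sup>2)) \<partial>circle_measure)"
    proof (rule nn_integral_cong_AE)
      show "AE z in circle_measure. ennreal ((cmod (h z - S n z))\<^sup>2) =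
          liminf (\<lambda>j. ennreal ((cmod (S (r j) z - S n z))\<^sup>2))"
        using conv
      proof eventually_elim
        fix z assume "convergent (\<lambda>j. S (r j) z)"
        then have "(\<lambda>j. S (r j) z) \<longlonglongrightarrow> h z"
          by (simp add: convergent_LIMSEQ_iff h_def)
        then have "(\<lambda>j. ennreal ((cmod (S (r j) z - S n z))\<^sup>2)) \<longlonglongrightarrow> ennreal ((cmod (h z - S n z))\<^sup>2)"
          by (intro tendsto_intros tendsto_ennrealI)
        then show "ennreal ((cmod (h z - S n z))\<^sup>2) =
          liminf (\<lambda>j. ennreal ((cmod (S (r j) z - S n z))\<^sup>2))"
          by (intro lim_imp_Liminf[symmetric]) auto
      qed
    qed
    also have "\<dots> \<le> liminf (\<lambda>j. \<integral>\<^sup>+z. ennreal ((cmod (S (r j) z - S n z))\<^sup>2) \<partial>circle_measure)"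
      by (intro nn_integral_liminf) measurable
    also have "\<dots> \<le> ennreal e"
    proof (rule Liminf_le)
      have "(\<integral>\<^sup>+z. ennreal ((cmod (S (r j) z - S n z))\<^sup>2) \<partial>circle_measure) \<le> ennreal e" if "j \<ge> N" for j
      proof -
        have "(\<integral>\<^sup>+z. ennreal ((cmod (S (r j) z - S n z))\<^sup>2) \<partial>circle_measure) =
            ennreal (\<integral>z. (cmod (S (r j) z - S n z))\<^sup>2 \<partial>circle_measure)"
          by (intro nn_integral_eq_integral L2_circleD(2) L2_circle_diff S_L2) simp
        also have "\<dots> \<le> ennreal e"
          using \<open>n \<ge> N\<close> that r_ge(3)[of j] by (intro ennreal_leI N) simp_all
        finally show ?thesis .
      qed
      then show "\<forall>\<^sub>F j in sequentially.
          (\<integral>\<^sup>+z. ennreal ((cmod (S (r j) z - S n z))\<^sup>2) \<partial>circle_measure) \<le> ennreal e"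
        by (rule eventually_sequentiallyI)
    qed simp
    finally show ?thesis .
  qed
  \<comment> \<open>The bound 1 is arbitrary: \<open>h - S N\<close> is square integrable for one
    \<open>N\<close>, and \<open>S N\<close> is added back.\<close>
  have h_L2: "h \<in> L2_circle"
  proof -
    obtain N where "\<And>m k. m \<ge> N \<Longrightarrow> k \<ge> N \<Longrightarrow> (\<integral>z. (cmod (S k z - S m z))\<^sup>2 \<partial>circle_measure) \<le> 1"
      using Cauchy[of 1] by auto
    from hS_nn[OF this order_refl]
    have "(\<integral>\<^sup>+z. ennreal ((cmod (h z - S N z))\<^sup>2) \<partial>circle_measure) \<le> ennreal 1" .
    then have "(\<integral>\<^sup>+z. ennreal ((cmod (h z - S N z))\<^sup>2) \<partial>circle_measure) < \<infinity>"
      by (rule order.strict_trans1) simp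
    then have "integrable circle_measure (\<lambda>z. (cmod (h z - S N z))\<^sup>2)"
      by (intro integrableI_bounded) auto
    then have "(\<lambda>z. h z - S N z) \<in> L2_circle"
      by (simp add: L2_circle_def)
    from L2_circle_add[OF this S_L2[of N]] show ?thesis
      by simp
  qed
  have "(\<lambda>n. \<integral>z. (cmod (h z - S n z))\<^sup>2 \<partial>circle_measure) \<longlonglongrightarrow> 0"
  proof (rule LIMSEQ_I)
    fix e :: real assume "e > 0"
    \<comment> \<open>Half of \<open>e\<close>, because Fatou gives only a weak inequality.\<close>
    then obtain N where N: "\<And>m k. m \<ge> N \<Longrightarrow> k \<ge> N \<Longrightarrow>
        (\<integral>z. (cmod (S k z - S m z))\<^sup>2 \<partial>circle_measure) \<le> e / 2"
      using Cauchy[of "e / 2"] by auto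
    have "norm ((\<integral>z. (cmod (h z - S n z))\<^sup>2 \<partial>circle_measure) - 0) < e" if "n \<ge> N" for n
    proof -
      have "ennreal (\<integral>z. (cmod (h z - S n z))\<^sup>2 \<partial>circle_measure) =
          (\<integral>\<^sup>+z. ennreal ((cmod (h z - S n z))\<^sup>2) \<partial>circle_measure)"
        by (intro nn_integral_eq_integral[symmetric] L2_circleD(2) L2_circle_diff h_L2 S_L2) simp
      also have "\<dots> \<le> ennreal (e / 2)"
        using hS_nn N that by blast
      finally have "(\<integral>z. (cmod (h z - S n z))\<^sup>2 \<partial>circle_measure) \<le> e / 2"
        using \<open>e > 0\<close> by (simp add: ennreal_le_iff)
      with \<open>e > 0\<close> show ?thesis
        by simp
    qed
    then show "\<exists>N. \<forall>n\<ge>N. norm ((\<integral>z. (cmod (h z - S n z))\<^sup>2 \<partial>circle_measure) - 0) < e"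
      by blast
  qed
  then have "L2_sums a h"
    using h_L2 by (simp add: L2_sums_def S_def)
  then show ?thesis
    by (rule that)
qed

section \<open>Orthogonal projection onto the Hardy space of the circle\<close>

lemma hardy2_circleI: "summable (\<lambda>n. (cmod (a n))\<^sup>2) \<Longrightarrow> L2_sums a g \<Longrightarrow> g \<in> hardy2_circle"
  unfolding hardy2_circle_def by (rule CollectI, rule exI, rule conjI)

lemma hardy2_circleE:
  assumes "g \<in> hardy2_circle"
  obtains a where "summable (\<lambda>n. (cmod (a n))\<^sup>2)" "L2_sums a g"
  using assms unfolding hardy2_circle_def by (elim CollectE exE conjE)

lemma hardy2_circle_in_L2_circle: "g \<in> hardy2_circle \<Longrightarrow> g \<in> L2_circle"
  by (elim hardy2_circleE L2_sums_in_L2_circle)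

text \<open>The choice in \<open>P_plus\<close> is not vacuous: the witness is the function whose
  coefficients are the Fourier coefficients of \<open>u\<close> of nonnegative index. Bessel makes
  them square summable, and Riesz-Fischer sums them.\<close>

lemma P_plus_projection:
  assumes "u \<in> L2_circle"
  shows "P_plus u \<in> hardy2_circle" "g \<in> hardy2_circle \<Longrightarrow> L2_inner (\<lambda>z. u z - P_plus u z) g = 0"
proof -
  obtain h where h: "L2_sums (\<lambda>n. L2_inner u (\<lambda>z. z ^ n)) h"
    using Riesz_Fischer[OF Bessel_inequality[OF assms]] .
  have h_L2: "h \<in> L2_circle"
    using h by (rule L2_sums_in_L2_circle)
  have ortho: "L2_inner (\<lambda>z. u z - h z) g = 0" if g: "g \<in> hardy2_circle" for g
  proof -
    obtain b where b: "L2_sums b g"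
      using hardy2_circleE[OF g] .
    have "L2_inner (\<lambda>z. u z - h z) (\<lambda>z. z ^ n) = 0" for n
      using L2_sums_inner_power[OF h] by (simp add: L2_inner_diff assms h_L2 power_in_L2_circle)
    then show ?thesis
      by (rule L2_inner_L2_sums_eq_0[OF L2_circle_diff[OF assms h_L2] b])
  qed
  let ?Q = "\<lambda>h. h \<in> hardy2_circle \<and> (\<forall>g\<in>hardy2_circle. L2_inner (\<lambda>z. u z - h z) g = 0)"
  have "?Q h"
    by (rule conjI[OF hardy2_circleI[OF Bessel_inequality[OF assms] h] ballI[OF ortho]])
  then have "?Q (P_plus u)"
    unfolding P_plus_def by (rule someI[of ?Q])
  then show "P_plus u \<in> hardy2_circle"
    "g \<in> hardy2_circle \<Longrightarrow> L2_inner (\<lambda>z. u z - P_plus u z) g = 0"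
    by simp_all
qed

section \<open>Toeplitz operators on the Hardy space\<close>

lemma taylor_coeff_sums:
  assumes "f holomorphic_on unit_disc" "z \<in> unit_disc"
  shows "(\<lambda>n. taylor_coeff f n * z ^ n) sums f z"
proof -
  have "f has_fps_expansion fps_expansion f 0"
    using assms(1) by (intro has_fps_expansion_fps_expansion[of unit_disc]) auto
  then show ?thesis
    unfolding taylor_coeff_def
    by (rule has_fps_expansion_imp_sums_complex[where r = 1]) (use assms in auto)
qed

text \<open>The way to compute \<open>taylor_coeff\<close>: any series representing \<open>f\<close>
  on the disc is its Taylor series, by uniqueness of expansions at 0.\<close>

lemma power_series_unit_disc:
  assumes "\<And>z. z \<in> unit_disc \<Longrightarrow> (\<lambda>n. a n * z ^ n) sums f z"
  shows "f holomorphic_on unit_disc" "taylor_coeff f = a"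
proof -
  \<comment> \<open>Convergence at every real point between 0 and 1 suffices for the radius.\<close>
  have "1 \<le> conv_radius a"
  proof (rule conv_radius_geI_ex')
    fix r :: real assume "0 < r" "ereal r < 1"
    then show "summable (\<lambda>n. a n * of_real r ^ n)"
      using assms[of "of_real r"] by (auto simp: sums_iff)
  qed
  then have R: "1 \<le> fps_conv_radius (Abs_fps a)"
    by (simp add: fps_conv_radius_def)
  have eq: "eval_fps (Abs_fps a) z = f z" if "z \<in> unit_disc" for z
    using assms[OF that] by (simp add: eval_fps_def sums_iff)
  have "unit_disc \<subseteq> eball 0 (fps_conv_radius (Abs_fps a))"
    using R by (auto simp: in_eball_iff intro!: less_le_trans[OF _ R])
  then have "eval_fps (Abs_fps a) holomorphic_on unit_disc"
    by (rule holomorphic_on_eval_fps)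
  then show "f holomorphic_on unit_disc"
    by (rule holomorphic_transform[OF _ eq])
  have "\<forall>\<^sub>F z in nhds 0. z \<in> unit_disc"
    by (intro eventually_nhds_in_open) auto
  then have "\<forall>\<^sub>F z in nhds 0. eval_fps (Abs_fps a) z = f z"
    by eventually_elim (rule eq)
  moreover have "0 < fps_conv_radius (Abs_fps a)"
    using R by (rule less_le_trans[rotated]) simp
  ultimately have "f has_fps_expansion Abs_fps a"
    by (simp add: has_fps_expansion_def)
  then show "taylor_coeff f = a"
    by (auto simp: taylor_coeff_def fps_expansion_eqI)
qed

text \<open>Square summable coefficients are eventually at most 1 in modulus, so the series is
  dominated by a geometric one. \<open>F\<close> is set to 0 off the disc as \<open>hardy2\<close>
  demands.\<close>

lemma hardy2_of_coeffs:
  assumes "summable (\<lambda>n. (cmod (a n))\<^sup>2)"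
  obtains F where "F \<in> hardy2" "taylor_coeff F = a"
proof -
  define F where "F z = (if z \<in> unit_disc then \<Sum>n. a n * z ^ n else 0)" for z
  have "(\<lambda>n. a n * z ^ n) sums F z" if z: "z \<in> unit_disc" for z
  proof -
    have "(\<lambda>n. (cmod (a n))\<^sup>2) \<longlonglongrightarrow> 0"
      using assms by (rule summable_LIMSEQ_zero)
    then have "\<forall>\<^sub>F n in sequentially. (cmod (a n))\<^sup>2 < 1"
      by (rule order_tendstoD) simp
    then have "\<forall>\<^sub>F n in sequentially. norm (a n * z ^ n) \<le> cmod z ^ n"
    proof eventually_elim
      fix n assume "(cmod (a n))\<^sup>2 < 1"
      then have "cmod (a n) \<le> 1"
        by (simp add: abs_square_less_1 less_imp_le)
      then show "norm (a n * z ^ n) \<le> cmod z ^ n"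
        by (simp add: norm_mult norm_power mult_left_le_one_le)
    qed
    moreover have "summable (\<lambda>n. cmod z ^ n)"
      using z by (intro summable_geometric) auto
    ultimately have "summable (\<lambda>n. a n * z ^ n)"
      by (rule summable_comparison_test_ev)
    then show ?thesis
      using z by (simp add: F_def summable_sums)
  qed
  note F = power_series_unit_disc[of a F, OF this]
  have "F \<in> hardy2"
    using F assms by (auto simp: hardy2_def F_def)
  with F(2) that show ?thesis by blast
qed

text \<open>Equality of total functions, thanks to the value 0 off the disc; the definite
  description in \<open>toeplitz\<close> relies on it.\<close>

lemma hardy2_eqI:
  assumes "F \<in> hardy2" "G \<in> hardy2" "taylor_coeff F = taylor_coeff G"
  shows "F = G"
proof
  fix z
  show "F z = G z"
  proof (cases "z \<in> unit_disc")
    case True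
    have "F holomorphic_on unit_disc" "G holomorphic_on unit_disc"
      using assms by (simp_all add: hardy2_def)
    then have "(\<lambda>n. taylor_coeff G n * z ^ n) sums F z" "(\<lambda>n. taylor_coeff G n * z ^ n) sums G z"
      using True taylor_coeff_sums[of F z] taylor_coeff_sums[of G z] by (simp_all add: assms(3))
    then show ?thesis
      by (rule sums_unique2)
  next
    case False
    then show ?thesis
      using assms(1,2) by (simp add: hardy2_def)
  qed
qed

section \<open>Boundary functions and the Toeplitz operator\<close>

lemma L2_sums_boundary:
  assumes "f \<in> hardy2"
  shows "L2_sums (taylor_coeff f) (boundary f)"
proof -
  have "summable (\<lambda>n. (cmod (taylor_coeff f n))\<^sup>2)"
    using assms by (simp add: hardy2_def)
  then obtain h where "L2_sums (taylor_coeff f) h"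
    by (rule Riesz_Fischer)
  then show ?thesis
    unfolding boundary_def by (rule someI[of "L2_sums (taylor_coeff f)"])
qed

text \<open>The definite description denotes: the coefficients of the projected function define an
  element of \<open>hardy2\<close> with the right boundary function.\<close>

lemma toeplitz_in_hardy2:
  assumes "\<phi> \<in> Linf_circle" "f \<in> hardy2"
  shows "toeplitz \<phi> f \<in> hardy2"
    and "AE z in circle_measure. boundary (toeplitz \<phi> f) z = P_plus (\<lambda>z. \<phi> z * boundary f z) z"
proof -
  let ?u = "\<lambda>z. \<phi> z * boundary f z"
  have u: "?u \<in> L2_circle"
    by (intro Linf_mult_L2_circle assms L2_sums_in_L2_circle[OF L2_sums_boundary])
  obtain a where a: "summable (\<lambda>n. (cmod (a n))\<^sup>2)" "L2_sums a (P_plus ?u)"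
    using hardy2_circleE[OF P_plus_projection(1)[OF u]] .
  obtain F where F: "F \<in> hardy2" "taylor_coeff F = a"
    using hardy2_of_coeffs[OF a(1)] .
  have "L2_sums a (boundary F)"
    using L2_sums_boundary[OF F(1)] by (simp only: F(2))
  then have bF: "AE z in circle_measure. boundary F z = P_plus ?u z"
    using a(2) by (rule L2_sums_unique_AE)
  \<comment> \<open>Taylor coefficients are Fourier coefficients of the boundary function, which
    depend only on its class modulo null sets.\<close>
  have unique: "G = F" if G: "G \<in> hardy2" "AE z in circle_measure. boundary G z = P_plus ?u z" for G
  proof (rule hardy2_eqI[OF G(1) F(1)], rule ext)
    fix n
    note bG = L2_sums_boundary[OF G(1)]
    have "taylor_coeff G n = L2_inner (boundary G) (\<lambda>z. z ^ n)"
      by (rule L2_sums_inner_power[OF bG, symmetric])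
    also have "\<dots> = L2_inner (P_plus ?u) (\<lambda>z. z ^ n)"
      by (rule L2_inner_cong_AE[OF L2_sums_in_L2_circle[OF bG] L2_sums_in_L2_circle[OF a(2)]
            power_in_L2_circle power_in_L2_circle G(2)]) simp
    also have "\<dots> = taylor_coeff F n"
      unfolding F(2) by (rule L2_sums_inner_power[OF a(2)])
    finally show "taylor_coeff G n = taylor_coeff F n" .
  qed
  have "toeplitz \<phi> f = F"
    unfolding toeplitz_def
  proof (rule the_equality)
    show "F \<in> hardy2 \<and> (AE z in circle_measure. boundary F z = P_plus ?u z)"
      using F(1) bF by (rule conjI)
    show "G = F" if "G \<in> hardy2 \<and> (AE z in circle_measure. boundary G z = P_plus ?u z)" for G
      using that[THEN conjunct1] that[THEN conjunct2] by (rule unique)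
  qed
  with F(1) bF show "toeplitz \<phi> f \<in> hardy2"
    "AE z in circle_measure. boundary (toeplitz \<phi> f) z = P_plus ?u z"
    by (simp_all only:)
qed

lemma boundary_in_hardy2_circle: "f \<in> hardy2 \<Longrightarrow> boundary f \<in> hardy2_circle"
  by (rule hardy2_circleI[OF _ L2_sums_boundary]) (simp_all add: hardy2_def)

lemma hardy_inner_eq_L2_inner:
  assumes "f \<in> hardy2" "g \<in> hardy2"
  shows "hardy_inner f g = L2_inner (boundary f) (boundary g)"
  using L2_inner_L2_sums[OF L2_sums_in_L2_circle[OF L2_sums_boundary[OF assms(1)]]
      L2_sums_boundary[OF assms(2)]]
  by (simp add: L2_sums_inner_power[OF L2_sums_boundary[OF assms(1)]] hardy_inner_def sums_iff)

lemma hardy_inner_toeplitz: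
  assumes "\<phi> \<in> Linf_circle" "f \<in> hardy2" "g \<in> hardy2"
  shows "hardy_inner (toeplitz \<phi> f) g = L2_inner (\<lambda>z. \<phi> z * boundary f z) (boundary g)"
proof -
  define u where "u z = \<phi> z * boundary f z" for z
  have u: "u \<in> L2_circle"
    unfolding u_def
    by (intro Linf_mult_L2_circle assms L2_sums_in_L2_circle[OF L2_sums_boundary])
  have Pu: "P_plus u \<in> L2_circle"
    by (rule hardy2_circle_in_L2_circle[OF P_plus_projection(1)[OF u]])
  note T = toeplitz_in_hardy2[OF assms(1,2), folded u_def]
  note L2 = L2_sums_in_L2_circle[OF L2_sums_boundary]
  have "hardy_inner (toeplitz \<phi> f) g = L2_inner (boundary (toeplitz \<phi> f)) (boundary g)"
    by (rule hardy_inner_eq_L2_inner[OF T(1) assms(3)])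
  also have "\<dots> = L2_inner (P_plus u) (boundary g)"
    using T assms(3) Pu by (intro L2_inner_cong_AE L2) auto
  \<comment> \<open>The residual \<open>u - P_plus u\<close> is orthogonal to
    \<open>boundary g\<close>.\<close>
  also have "\<dots> = L2_inner u (boundary g)"
    using P_plus_projection(2)[OF u boundary_in_hardy2_circle[OF assms(3)]]
    by (simp add: L2_inner_diff[OF u Pu L2[OF assms(3)]])
  finally show ?thesis
    by (simp add: u_def[abs_def])
qed

section \<open>Reproducing kernels\<close>

text \<open>The point \<open>z\<close> ranges over the closed disc, to cover both the power series
  inside and the boundary values on the circle.\<close>

lemma geometric_unit_disc:
  assumes "w \<in> unit_disc" "cmod z \<le> 1"
  shows "cmod (cnj w * z) < 1" "1 - cnj w * z \<noteq> 0"
proof -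
  have "cmod w * cmod z \<le> cmod w"
    using assms(2) by (simp add: mult_left_le)
  also have "\<dots> < 1"
    using assms(1) by simp
  finally show "cmod (cnj w * z) < 1"
    by (simp add: norm_mult)
  then show "1 - cnj w * z \<noteq> 0"
    by auto
qed

text \<open>Geometric series in \<open>cnj w * z\<close>. The norm of the kernel stays symbolic here
  and below: it is never evaluated, and the slice condition eliminates it in the end.\<close>

lemma taylor_coeff_nkernel:
  assumes "w \<in> unit_disc"
  shows "nkernel w holomorphic_on unit_disc"
    "taylor_coeff (nkernel w) = (\<lambda>n. cnj w ^ n / of_real (hardy_norm (kernel w)))"
proof -
  have "(\<lambda>n. cnj w ^ n / of_real (hardy_norm (kernel w)) * z ^ n) sums nkernel w z"
    if z: "z \<in> unit_disc" for z
  proof -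
    have "(\<lambda>n. (cnj w * z) ^ n) sums (1 / (1 - cnj w * z))"
      using z geometric_unit_disc[OF assms, of z] by (intro geometric_sums) simp
    from sums_divide[OF this, of "of_real (hardy_norm (kernel w))"] z show ?thesis
      by (simp add: nkernel_def kernel_def power_mult_distrib)
  qed
  from power_series_unit_disc[OF this]
  show "nkernel w holomorphic_on unit_disc"
    "taylor_coeff (nkernel w) = (\<lambda>n. cnj w ^ n / of_real (hardy_norm (kernel w)))"
    by auto
qed

text \<open>The squared moduli of the coefficients form a geometric series of ratio
  \<open>|w|^2\<close>.\<close>

lemma nkernel_in_hardy2:
  assumes "w \<in> unit_disc"
  shows "nkernel w \<in> hardy2"
proof -
  have "(cmod w)\<^sup>2 < 1"
    using assms by (simp add: power_less_one_iff)
  then have "summable (\<lambda>n. ((cmod w)\<^sup>2) ^ n / (hardy_norm (kernel w))\<^sup>2)"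
    by (intro summable_divide summable_geometric) simp
  then have "summable (\<lambda>n. (cmod (taylor_coeff (nkernel w) n))\<^sup>2)"
    by (simp add: taylor_coeff_nkernel[OF assms] norm_divide norm_power power_divide
        flip: power_mult) (simp add: mult.commute)
  moreover have "nkernel w z = 0" if "z \<notin> unit_disc" for z
    using that by (simp add: nkernel_def kernel_def)
  ultimately show ?thesis
    using taylor_coeff_nkernel(1)[OF assms] by (simp add: hardy2_def)
qed

lemma hardy_inner_nkernel:
  assumes "w1 \<in> unit_disc" "w2 \<in> unit_disc"
  shows "hardy_inner (nkernel w1) (nkernel w2) =
    1 / ((1 - cnj w1 * w2) * of_real (hardy_norm (kernel w1) * hardy_norm (kernel w2)))"
proof -
  have "(\<lambda>n. (cnj w1 * w2) ^ n) sums (1 / (1 - cnj w1 * w2))"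
    using assms geometric_unit_disc[of w1 w2] by (intro geometric_sums) simp
  from sums_divide[OF this, of "of_real (hardy_norm (kernel w1) * hardy_norm (kernel w2))"]
  show ?thesis
    by (simp add: hardy_inner_def taylor_coeff_nkernel(2)[OF assms(1)] taylor_coeff_nkernel(2)[OF assms(2)]
        sums_iff power_mult_distrib)
qed

text \<open>The kernel formula makes sense on the circle, and its geometric series converges
  uniformly there, hence in \<open>L2\<close>.\<close>

lemma L2_sums_nkernel:
  assumes "w \<in> unit_disc"
  shows "L2_sums (taylor_coeff (nkernel w)) (\<lambda>z. 1 / (1 - cnj w * z) / of_real (hardy_norm (kernel w)))"
    (is "L2_sums _ ?k")
proof -
  define c where "c = hardy_norm (kernel w)"
  have w: "cmod w < 1"
    using assms by simp
  have meas: "continuous_on (sphere 0 1) ?k"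
    using geometric_unit_disc(2)[OF assms]
    by (cases "hardy_norm (kernel w) = 0") (auto intro!: continuous_intros)
  \<comment> \<open>Remainder of the geometric series after \<open>N\<close> terms.\<close>
  have rem: "?k z - (\<Sum>n<N. taylor_coeff (nkernel w) n * z ^ n) =
      (cnj w * z) ^ N / ((1 - cnj w * z) * of_real c)" if "cmod z \<le> 1" for z N
  proof -
    have nz: "1 - cnj w * z \<noteq> 0"
      using geometric_unit_disc(2)[OF assms that] .
    have "(\<Sum>n<N. taylor_coeff (nkernel w) n * z ^ n) = (\<Sum>n<N. (cnj w * z) ^ n) / of_real c"
      by (simp add: taylor_coeff_nkernel[OF assms] c_def sum_divide_distrib power_mult_distrib)
    also have "(\<Sum>n<N. (cnj w * z) ^ n) = (1 - (cnj w * z) ^ N) / (1 - cnj w * z)"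
      using nz by (simp add: sum_gp_strict)
    finally show ?thesis
      \<comment> \<open>For \<open>c = 0\<close> both sides are 0, by the convention for division by
        zero.\<close>
      using nz by (cases "c = 0") (simp_all add: c_def divide_simps)
  qed
  \<comment> \<open>On the circle \<open>|1 - cnj w * z|\<close> is at least \<open>1 - |w|\<close>,
    so \<open>C\<close> bounds the remainder up to the factor \<open>|w|^N\<close>.\<close>
  define C where "C = 1 / ((1 - cmod w) * \<bar>c\<bar>)"
  have bound: "(cmod (?k z - (\<Sum>n<N. taylor_coeff (nkernel w) n * z ^ n)))\<^sup>2 \<le> ((cmod w)\<^sup>2) ^ N * C\<^sup>2"
    if z: "z \<in> sphere 0 1" for z N
  proof -
    have z1: "cmod z \<le> 1"
      using z by simp
    have "1 - cmod w \<le> cmod (1 - cnj w * z)"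
      using norm_triangle_ineq2[of 1 "cnj w * z"] z by (simp add: norm_mult)
    then have "1 / (cmod (1 - cnj w * z) * \<bar>c\<bar>) \<le> C"
      unfolding C_def using w
      by (cases "c = 0") (auto intro!: divide_left_mono mult_right_mono mult_pos_pos)
    then have "cmod w ^ N * (1 / (cmod (1 - cnj w * z) * \<bar>c\<bar>)) \<le> cmod w ^ N * C"
      by (intro mult_left_mono) auto
    then have "cmod (?k z - (\<Sum>n<N. taylor_coeff (nkernel w) n * z ^ n)) \<le> cmod w ^ N * C"
      unfolding rem[OF z1] using z by (simp add: norm_divide norm_mult norm_power)
    then have "(cmod (?k z - (\<Sum>n<N. taylor_coeff (nkernel w) n * z ^ n)))\<^sup>2 \<le> (cmod w ^ N * C)\<^sup>2"
      by (intro power_mono) auto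
    then show ?thesis
      by (simp add: power_mult_distrib mult.commute flip: power_mult)
  qed
  \<comment> \<open>For \<open>N = 0\<close> the partial sum is empty, so \<open>bound\<close>
    controls the kernel itself.\<close>
  have k: "?k \<in> L2_circle"
  proof (rule bounded_in_L2_circle)
    show "?k \<in> borel_measurable circle_measure"
      by (rule borel_measurable_circle_continuousI[OF meas])
    have "(cmod (?k z))\<^sup>2 \<le> C\<^sup>2" if "z \<in> sphere 0 1" for z
      using bound[OF that, of 0] by simp
    then have "cmod (?k z) \<le> \<bar>C\<bar>" if "z \<in> sphere 0 1" for z
      using that abs_le_square_iff[of "cmod (?k z)" C] by auto
    then show "AE z in circle_measure. cmod (?k z) \<le> \<bar>C\<bar>"
      by (intro AE_I2) simp
  qed
  have "(\<lambda>N. \<integral>z. (cmod (?k z - (\<Sum>n<N. taylor_coeff (nkernel w) n * z ^ n)))\<^sup>2 \<partial>circle_measure) \<longlonglongrightarrow> 0"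
  proof (rule Lim_null_comparison)
    show "\<forall>\<^sub>F N in sequentially.
        norm (\<integral>z. (cmod (?k z - (\<Sum>n<N. taylor_coeff (nkernel w) n * z ^ n)))\<^sup>2 \<partial>circle_measure)
          \<le> ((cmod w)\<^sup>2) ^ N * C\<^sup>2"
    proof (intro always_eventually allI)
      fix N
      have "(\<integral>z. (cmod (?k z - (\<Sum>n<N. taylor_coeff (nkernel w) n * z ^ n)))\<^sup>2 \<partial>circle_measure)
          \<le> (\<integral>z. ((cmod w)\<^sup>2) ^ N * C\<^sup>2 \<partial>circle_measure)"
        using bound
        by (intro integral_mono L2_circleD(2) L2_circle_diff[OF k poly_in_L2_circle]) auto
      then show "norm (\<integral>z. (cmod (?k z - (\<Sum>n<N. taylor_coeff (nkernel w) n * z ^ n)))\<^sup>2 \<partial>circle_measure)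
          \<le> ((cmod w)\<^sup>2) ^ N * C\<^sup>2"
        by (simp add: measure_circle_measure)
    qed
    have "(\<lambda>N. ((cmod w)\<^sup>2) ^ N * C\<^sup>2) \<longlonglongrightarrow> 0 * C\<^sup>2"
      using w by (intro tendsto_intros LIMSEQ_power_zero) (simp add: power_less_one_iff)
    then show "(\<lambda>N. ((cmod w)\<^sup>2) ^ N * C\<^sup>2) \<longlonglongrightarrow> 0"
      by simp
  qed
  with k show ?thesis
    by (simp add: L2_sums_def)
qed

section \<open>The Toeplitz form on normalized kernels as an integral\<close>

lemma boundary_nkernel_AE:
  assumes "w \<in> unit_disc"
  shows "AE z in circle_measure. boundary (nkernel w) z = 1 / (1 - cnj w * z) / of_real (hardy_norm (kernel w))"
  by (rule L2_sums_unique_AE[OF L2_sums_boundary[OF nkernel_in_hardy2[OF assms]] L2_sums_nkernel[OF assms]])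

lemma hardy_inner_toeplitz_nkernel:
  assumes "\<phi> \<in> Linf_circle" "w1 \<in> unit_disc" "w2 \<in> unit_disc"
    and q: "hardy_inner (nkernel w1) (nkernel w2) = of_real q"
  shows "hardy_inner (toeplitz \<phi> (nkernel w1)) (nkernel w2) =
    of_real (q / (2 * pi)) *
       (LINT t:{0..2*pi}|lborel.
          \<phi> (cis t) * (1 - cnj w1 * w2) / ((1 - cnj w1 * cis t) * (1 - w2 * cis (- t))))"
proof -
  define k where "k w z = 1 / (1 - cnj w * z) / of_real (hardy_norm (kernel w))" for w z
  note L2 = L2_sums_in_L2_circle[OF L2_sums_boundary[OF nkernel_in_hardy2]]
  have k: "k w \<in> L2_circle" "AE z in circle_measure. boundary (nkernel w) z = k w z"
    if "w \<in> unit_disc" for w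
    using L2_sums_in_L2_circle[OF L2_sums_nkernel[OF that]] boundary_nkernel_AE[OF that]
    by (simp_all add: k_def[abs_def])
  have \<phi>k: "(\<lambda>z. \<phi> z * k w1 z) \<in> L2_circle"
    by (intro Linf_mult_L2_circle assms k)
  have "1 - cnj w1 * w2 \<noteq> 0"
    using geometric_unit_disc(2)[of w1 w2] assms by simp
  \<comment> \<open>The slice condition is multiplied by the nonzero number
    \<open>1 - cnj w1 * w2\<close>.\<close>
  then have norms: "1 / (of_real (hardy_norm (kernel w1)) * of_real (hardy_norm (kernel w2))) =
      of_real q * (1 - cnj w1 * w2)"
    unfolding q[unfolded hardy_inner_nkernel[OF assms(2,3)], symmetric]
    by (simp add: mult.assoc)
  have "hardy_inner (toeplitz \<phi> (nkernel w1)) (nkernel w2) =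
      L2_inner (\<lambda>z. \<phi> z * boundary (nkernel w1) z) (boundary (nkernel w2))"
    by (intro hardy_inner_toeplitz nkernel_in_hardy2 assms)
  also have "\<dots> = L2_inner (\<lambda>z. \<phi> z * k w1 z) (k w2)"
  proof (rule L2_inner_cong_AE)
    show "AE z in circle_measure. \<phi> z * boundary (nkernel w1) z = \<phi> z * k w1 z"
      using k(2)[OF assms(2)] by eventually_elim simp
  qed (use assms k L2 \<phi>k in \<open>auto intro: Linf_mult_L2_circle\<close>)
  also have "\<dots> = of_real (1 / (2*pi)) * (LINT t:{0..2*pi}|lborel. \<phi> (cis t) * k w1 (cis t) * cnj (k w2 (cis t)))"
    unfolding L2_inner_def
    by (intro integral_circle_measure borel_measurable_integrable L2_circle_integrable_mult \<phi>k k assms)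
  also have "(\<lambda>t. \<phi> (cis t) * k w1 (cis t) * cnj (k w2 (cis t))) =
      (\<lambda>t. of_real q * (\<phi> (cis t) * (1 - cnj w1 * w2) / ((1 - cnj w1 * cis t) * (1 - w2 * cis (- t)))))"
  proof
    fix t
    have "\<phi> (cis t) * k w1 (cis t) * cnj (k w2 (cis t)) =
        \<phi> (cis t) / ((1 - cnj w1 * cis t) * (1 - w2 * cis (- t))) *
        (1 / (of_real (hardy_norm (kernel w1)) * of_real (hardy_norm (kernel w2))))"
      \<comment> \<open>Conjugation turns \<open>cnj w2 * cis t\<close> into
        \<open>w2 * cis (- t)\<close>.\<close>
      by (simp add: k_def cis_cnj)
    then show "\<phi> (cis t) * k w1 (cis t) * cnj (k w2 (cis t)) =
        of_real q * (\<phi> (cis t) * (1 - cnj w1 * w2) / ((1 - cnj w1 * cis t) * (1 - w2 * cis (- t))))"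
      unfolding norms by simp
  qed
  finally show ?thesis
    unfolding set_integral_mult_right by (simp only: of_real_mult of_real_divide) simp
qed

theorem proposition3p7:
  fixes q :: real and \<phi> :: "complex \<Rightarrow> complex"
  assumes "0 < q" and "q \<le> 1"
    and "\<phi> \<in> Linf_circle"
  shows "q_berezin_range q (toeplitz \<phi>) =
    {of_real (q / (2 * pi)) *
       (LINT t:{0..2*pi}|lborel.
          \<phi> (cis t) * (1 - cnj w1 * w2) / ((1 - cnj w1 * cis t) * (1 - w2 * cis (- t))))
     | w1 w2. w1 \<in> unit_disc \<and> w2 \<in> q_slice q w1}"
proof -
  have eq: "hardy_inner (toeplitz \<phi> (nkernel w1)) (nkernel w2) =
    of_real (q / (2 * pi)) *
       (LINT t:{0..2*pi}|lborel.
          \<phi> (cis t) * (1 - cnj w1 * w2) / ((1 - cnj w1 * cis t) * (1 - w2 * cis (- t))))"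
    if "w1 \<in> unit_disc" "w2 \<in> q_slice q w1" for w1 w2
    using that by (intro hardy_inner_toeplitz_nkernel assms(3)) (auto simp: q_slice_def)
  \<comment> \<open>Both sets have the same parameters \<open>w1\<close> and \<open>w2\<close>, so
    the pointwise identity \<open>eq\<close> suffices.\<close>
  show ?thesis
    unfolding q_berezin_range_def
    by (intro Collect_cong ex_cong1 iffI; elim conjE; simp only: eq simp_thms)
qed

end
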